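(* There is a constant $C>0$ such that the following holds for every $\epsilon\in(0,1)$. Let $\mathcal{E}$ be the ensemble of orthogonal matrices on $n$ qubits drawn from the two-layer superblock architecture with two layers of $m/2=n/(2\xi)$ superblocks each, where the superblocks are independent Haar-random elements of $\mathrm{O}(2^{2\xi})$ and $\xi\ge C\log_2(n/\epsilon)$ (so $\xi=O(\log(n/\epsilon))$ suffices). Then $\mathcal{E}$ anti-concentrates for $k=2$, i.e. $$\mathbb{E}_{O\sim\mathcal{E}}|\langle0^n|O|0^n\rangle|^4\le(1+\epsilon)\,\mathbb{E}_{O\sim\mathrm{O}(2^n)}|\langle0^n|O|0^n\rangle|^4,$$ where on the right $O$ is Haar-random in $\mathrm{O}(2^n)$.
   Context: $\mathrm{O}(D)$ is the group of real unitary $D\times D$ matrices. Two-layer superblock architecture: $n$ qubits on a line (with periodic boundary conditions) are divided into $m=n/\xi$ consecutive patches of $\xi$ qubits, $m$ even. In the first layer, independent random unitaries ("superblocks") are applied to the pairs of patches $(1,2),(3,4),\dots,(m-1,m)$; in the second layer, to the pairs $(2,3),(4,5),\dots,(m,1)$. Each superblock acts on $2\xi$ qubits. *)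

theory Defs
  imports "HOL-Probability.Probability" "Jordan_Normal_Form.Matrix"
begin

definition orthogonal_group :: "nat \<Rightarrow> real mat set" where
  "orthogonal_group D =
     {A \<in> carrier_mat D D. transpose_mat A * A = 1\<^sub>m D \<and> A * transpose_mat A = 1\<^sub>m D}"

text \<open>The Borel sets of the orthogonal group: \<^typ>\<open>real mat\<close> carries no topology, so the
  sigma-algebra is the one pulled back from \<open>D\<^sup>2\<close>-dimensional real space along the matrix entries.\<close>

definition orthogonal_borel :: "nat \<Rightarrow> real mat measure" where
  "orthogonal_borel D =
     vimage_algebra (orthogonal_group D)
       (\<lambda>A. \<lambda>ij\<in>{..<D} \<times> {..<D}. A $$ ij)
       (\<Pi>\<^sub>M ij\<in>{..<D} \<times> {..<D}. (borel :: real measure))"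

text \<open>By compactness of the group, exactly one measure satisfies this predicate for each \<open>D\<close>.\<close>

definition haar_orthogonal :: "nat \<Rightarrow> real mat measure \<Rightarrow> bool" where
  "haar_orthogonal D \<mu> \<longleftrightarrow>
     prob_space \<mu> \<and> sets \<mu> = sets (orthogonal_borel D) \<and>
     (\<forall>V\<in>orthogonal_group D.
        distr \<mu> (orthogonal_borel D) (\<lambda>A. V * A) = \<mu> \<and>
        distr \<mu> (orthogonal_borel D) (\<lambda>A. A * V) = \<mu>)"

text \<open>The computational basis state with index \<open>x < 2 ^ n\<close> has qubit \<open>q\<close> in state \<^term>\<open>bit x q\<close>;
  in particular \<open>0\<^sup>n\<close> has index 0. The restriction of \<open>x\<close> to a list of qubits is again read as a
  number, the head of the list being the least significant bit.\<close>

definition restrict_qubits :: "nat list \<Rightarrow> nat \<Rightarrow> nat" where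
  "restrict_qubits qs x = horner_sum of_bool 2 (map (bit x) qs)"

text \<open>The tensor product of the \<open>U i\<close>, \<open>i < r\<close>, where \<open>U i\<close> acts on the qubits \<open>qs i\<close>. The lists
  \<open>qs i\<close> are meant to partition the \<open>n\<close> qubits, so that no identity factors are left.\<close>

definition tensor_layer :: "nat \<Rightarrow> nat \<Rightarrow> (nat \<Rightarrow> nat list) \<Rightarrow> (nat \<Rightarrow> real mat) \<Rightarrow> real mat" where
  "tensor_layer n r qs U =
     mat (2 ^ n) (2 ^ n)
       (\<lambda>(x, y). \<Prod>i<r. U i $$ (restrict_qubits (qs i) x, restrict_qubits (qs i) y))"

text \<open>Patches are numbered from 0.\<close>

definition patch :: "nat \<Rightarrow> nat \<Rightarrow> nat list" where
  "patch \<xi> p = [p * \<xi> ..< (p + 1) * \<xi>]"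

definition first_layer_qubits :: "nat \<Rightarrow> nat \<Rightarrow> nat list" where
  "first_layer_qubits \<xi> i = patch \<xi> (2 * i) @ patch \<xi> (2 * i + 1)"

definition second_layer_qubits :: "nat \<Rightarrow> nat \<Rightarrow> nat \<Rightarrow> nat list" where
  "second_layer_qubits m \<xi> i = patch \<xi> (2 * i + 1) @ patch \<xi> ((2 * i + 2) mod m)"

text \<open>\<open>U (l, i)\<close> is superblock \<open>i\<close> of layer \<open>l\<close>; layer 0 is applied first.\<close>

definition two_layer_circuit :: "nat \<Rightarrow> nat \<Rightarrow> (nat \<times> nat \<Rightarrow> real mat) \<Rightarrow> real mat" where
  "two_layer_circuit m \<xi> U =
     tensor_layer (m * \<xi>) (m div 2) (second_layer_qubits m \<xi>) (\<lambda>i. U (1, i)) *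
     tensor_layer (m * \<xi>) (m div 2) (first_layer_qubits \<xi>) (\<lambda>i. U (0, i))"

text \<open>The law of the circuit on \<open>m * \<xi>\<close> qubits when the \<open>m\<close> superblocks are independent with law \<open>H\<close>.\<close>

definition two_layer_ensemble :: "nat \<Rightarrow> nat \<Rightarrow> real mat measure \<Rightarrow> real mat measure" where
  "two_layer_ensemble m \<xi> H =
     distr (\<Pi>\<^sub>M j\<in>{0, 1} \<times> {..<m div 2}. H) (orthogonal_borel (2 ^ (m * \<xi>))) (two_layer_circuit m \<xi>)"

end

(* Fourth moments of a uniformly random unit vector u in R^D are sums over the three pairings of
   four replicas: E[u_i u_j u_k u_l] = (sum of the pairing indicators) / (D (D + 2)). Expanding
   the fourth power of the circuit's (0,0) entry over the basis states between the layers gives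
   every superblock a pairing, and the superblocks form a ring, neighbours sharing a patch of
   dimension d = 2^xi. A patch contributes d^2 if its two pairings agree and d otherwise, so the
   moment is the trace of the m-th power of the 3x3 transfer matrix (d^2 - d) I + d J, divided by
   (D (D + 2))^m with D = d^2, i.e. ((d^2 + 2d)^m + 2 (d^2 - d)^m) / (D (D + 2))^m. Relative to
   the Haar value 3 / (N (N + 2)), N = d^m, this is at most (e^(2x) + 2) / 3 with x = m / d, and
   xi >= 2 log_2 (n / epsilon) makes x <= epsilon / 2. *)

theory Submission
  imports Defs
begin

section \<open>The orthogonal group\<close>

lemma measurable_entry:
  assumes "i < D" "j < D"
  shows "(\<lambda>A. A $$ (i, j)) \<in> borel_measurable (orthogonal_borel D)"
proof -
  have "(\<lambda>A. \<lambda>ij\<in>{..<D} \<times> {..<D}. A $$ ij) \<in>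
      measurable (orthogonal_borel D) (\<Pi>\<^sub>M ij\<in>{..<D} \<times> {..<D}. (borel :: real measure))"
    unfolding orthogonal_borel_def
    by (rule measurable_vimage_algebra1) (auto simp: space_PiM)
  from measurable_compose[OF this measurable_component_singleton[of "(i, j)"]]
  show ?thesis using assms by simp
qed

lemma space_orthogonal_borel: "space (orthogonal_borel D) = orthogonal_group D"
  by (simp add: orthogonal_borel_def)

lemma measurable_into_orthogonal_borel:
  assumes "\<And>x. x \<in> space M \<Longrightarrow> f x \<in> orthogonal_group D"
    and "\<And>i j. i < D \<Longrightarrow> j < D \<Longrightarrow> (\<lambda>x. f x $$ (i, j)) \<in> borel_measurable M"
  shows "f \<in> measurable M (orthogonal_borel D)"
  unfolding orthogonal_borel_def
  by (rule measurable_vimage_algebra2) (use assms in \<open>auto intro!: measurable_restrict\<close>)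

lemma orthogonal_group_transpose:
  "A \<in> orthogonal_group D \<Longrightarrow> transpose_mat A \<in> orthogonal_group D"
  by (auto simp: orthogonal_group_def)

lemma orthogonal_group_mult:
  assumes "A \<in> orthogonal_group D" "B \<in> orthogonal_group D"
  shows "A * B \<in> orthogonal_group D"
proof -
  have c: "A \<in> carrier_mat D D" "B \<in> carrier_mat D D"
    "transpose_mat A * A = 1\<^sub>m D" "A * transpose_mat A = 1\<^sub>m D"
    "transpose_mat B * B = 1\<^sub>m D" "B * transpose_mat B = 1\<^sub>m D"
    using assms by (auto simp: orthogonal_group_def)
  have t: "transpose_mat A \<in> carrier_mat D D" "transpose_mat B \<in> carrier_mat D D"
    using c by auto
  note assoc = assoc_mult_mat[where ?n\<^sub>1.0 = D and ?n\<^sub>2.0 = D and ?n\<^sub>3.0 = D and ?n\<^sub>4.0 = D]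
  have tAB: "transpose_mat (A * B) = transpose_mat B * transpose_mat A"
    using c by (simp add: transpose_mult)
  have "transpose_mat (A * B) * (A * B) = transpose_mat B * ((transpose_mat A * A) * B)"
    using c(1,2) t unfolding tAB by (simp add: assoc)
  moreover have "(A * B) * transpose_mat (A * B) = A * ((B * transpose_mat B) * transpose_mat A)"
    using c(1,2) t unfolding tAB by (simp add: assoc)
  ultimately show ?thesis
    using c t by (simp add: orthogonal_group_def)
qed

lemma orthogonal_group_row:
  assumes "A \<in> orthogonal_group D" "i < D" "k < D"
  shows "(\<Sum>j<D. A $$ (i, j) * A $$ (k, j)) = of_bool (i = k)"
proof -
  have "(A * transpose_mat A) $$ (i, k) = of_bool (i = k)" "A \<in> carrier_mat D D"
    using assms by (auto simp: orthogonal_group_def)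
  then show ?thesis using assms
    by (auto simp: scalar_prod_def lessThan_atLeast0)
qed

lemma orthogonal_group_col:
  assumes "A \<in> orthogonal_group D" "i < D" "k < D"
  shows "(\<Sum>j<D. A $$ (j, i) * A $$ (j, k)) = of_bool (i = k)"
proof -
  have "A \<in> carrier_mat D D" using assms by (auto simp: orthogonal_group_def)
  then show ?thesis
    using orthogonal_group_row[OF orthogonal_group_transpose[OF assms(1)] assms(2,3)] assms by simp
qed

text \<open>Rows are unit vectors, so no single square exceeds 1. This bound is what makes products
  of entries integrable under any probability measure on the group.\<close>

lemma orthogonal_group_entry_bound:
  assumes "A \<in> orthogonal_group D" "i < D" "j < D"
  shows "\<bar>A $$ (i, j)\<bar> \<le> 1"
proof -
  have "(A $$ (i, j))\<^sup>2 \<le> (\<Sum>j<D. (A $$ (i, j))\<^sup>2)"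
    using assms by (intro member_le_sum) auto
  also have "\<dots> = 1" using orthogonal_group_row[OF assms(1,2,2)] by (simp add: power2_eq_square)
  finally show ?thesis by (simp add: abs_square_le_1)
qed

text \<open>A reflection acting in the plane of the axes a and b, with block (p, q; q, -p). One
  family covers every symmetry used below: a sign flip (p = 1, q = 0), a swap (p = 0, q = 1) and a
  mixing by 45 degrees (p = q).\<close>

definition plane_reflection :: "nat \<Rightarrow> nat \<Rightarrow> nat \<Rightarrow> real \<Rightarrow> real \<Rightarrow> real mat" where
  "plane_reflection D a b p q = mat D D (\<lambda>(i, j).
     if i = a then of_bool (j = a) * p + of_bool (j = b) * q
     else if i = b then of_bool (j = a) * q - of_bool (j = b) * p
     else of_bool (i = j))"

text \<open>The action on coordinate vectors, free of matrices, so that rows and columns of a Haar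
  matrix can share one invariance condition.\<close>

definition reflect_coords :: "nat \<Rightarrow> nat \<Rightarrow> real \<Rightarrow> real \<Rightarrow> (nat \<Rightarrow> real) \<Rightarrow> nat \<Rightarrow> real" where
  "reflect_coords a b p q v i =
     (if i = a then p * v a + q * v b else if i = b then q * v a - p * v b else v i)"

lemma plane_reflection_sum:
  assumes "a < D" "b < D" "i < D"
  shows "(\<Sum>j<D. plane_reflection D a b p q $$ (i, j) * v j) = reflect_coords a b p q v i"
  using assms
  by (simp add: plane_reflection_def reflect_coords_def algebra_simps sum.distrib sum_subtractf
      of_bool_def if_distrib[of "\<lambda>x. x * _"] if_distrib[of "\<lambda>x. _ * x"] cong: if_cong)

lemma plane_reflection_symmetric:
  assumes "a \<noteq> b"
  shows "transpose_mat (plane_reflection D a b p q) = plane_reflection D a b p q"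
  using assms by (intro eq_matI) (auto simp: plane_reflection_def)

text \<open>By symmetry of the matrix, both orthogonality conditions reduce to its being an
  involution.\<close>

lemma plane_reflection_orthogonal:
  assumes "a < D" "b < D" "a \<noteq> b" "p\<^sup>2 + q\<^sup>2 = 1"
  shows "plane_reflection D a b p q \<in> orthogonal_group D" (is "?R \<in> _")
proof -
  have c: "?R \<in> carrier_mat D D" by (simp add: plane_reflection_def)
  have "?R * ?R = 1\<^sub>m D"
  proof (intro eq_matI)
    fix i j assume "i < dim_row (1\<^sub>m D)" "j < dim_col (1\<^sub>m D)"
    then have ij: "i < D" "j < D" by auto
    have "(?R * ?R) $$ (i, j) = (\<Sum>k<D. ?R $$ (i, k) * ?R $$ (k, j))"
      using c ij by (simp add: scalar_prod_def lessThan_atLeast0)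
    also have "\<dots> = reflect_coords a b p q (\<lambda>k. ?R $$ (k, j)) i"
      using assms ij by (simp add: plane_reflection_sum)
    also have "\<dots> = of_bool (i = j)"
      using assms ij
      by (auto simp: reflect_coords_def plane_reflection_def power2_eq_square algebra_simps)
    finally show "(?R * ?R) $$ (i, j) = 1\<^sub>m D $$ (i, j)" using ij by simp
  qed (use c in auto)
  then show ?thesis
    using c assms by (simp add: orthogonal_group_def plane_reflection_symmetric)
qed

section \<open>Fourth moments of invariant unit vectors\<close>

text \<open>Invariance is demanded only of fourth moments and only under plane reflections; together
  with the norm this already determines all fourth moments. Columns and rows of a Haar matrix are
  the two instances.\<close>

locale invariant_unit_vector = prob_space +
  fixes D :: nat and u :: "'a \<Rightarrow> nat \<Rightarrow> real"
  assumes dim: "2 \<le> D"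
    and measurable_coord [measurable]: "\<And>i. i < D \<Longrightarrow> (\<lambda>x. u x i) \<in> borel_measurable M"
    and unit: "\<And>x. x \<in> space M \<Longrightarrow> (\<Sum>i<D. (u x i)\<^sup>2) = 1"
    and reflect: "\<And>a b p q i j k l. a < D \<Longrightarrow> b < D \<Longrightarrow> a \<noteq> b \<Longrightarrow> p\<^sup>2 + q\<^sup>2 = 1 \<Longrightarrow>
      i < D \<Longrightarrow> j < D \<Longrightarrow> k < D \<Longrightarrow> l < D \<Longrightarrow>
      expectation (\<lambda>x. u x i * u x j * u x k * u x l) =
      expectation (\<lambda>x. reflect_coords a b p q (u x) i * reflect_coords a b p q (u x) j *
        reflect_coords a b p q (u x) k * reflect_coords a b p q (u x) l)"
begin

definition moment :: "nat \<Rightarrow> nat \<Rightarrow> nat \<Rightarrow> nat \<Rightarrow> real" where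
  "moment i j k l = expectation (\<lambda>x. u x i * u x j * u x k * u x l)"

lemma coord_bound:
  assumes "x \<in> space M" "i < D"
  shows "\<bar>u x i\<bar> \<le> 1"
proof -
  have "(u x i)\<^sup>2 \<le> (\<Sum>i<D. (u x i)\<^sup>2)"
    using assms by (intro member_le_sum) auto
  then show ?thesis using unit[OF assms(1)] by (simp add: abs_square_le_1)
qed

lemma integrable_quartic:
  assumes "i < D" "j < D" "k < D" "l < D"
  shows "integrable M (\<lambda>x. u x i * u x j * u x k * u x l)"
proof (rule integrable_const_bound)
  show "AE x in M. norm (u x i * u x j * u x k * u x l) \<le> 1"
    using assms by (auto simp: abs_mult intro!: mult_le_one coord_bound)
  show "(\<lambda>x. u x i * u x j * u x k * u x l) \<in> borel_measurable M"
    using assms by measurable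
qed

text \<open>Flipping the sign of coordinate i negates a moment in which i occurs once or three
  times. The index j only supplies the second axis of the plane, which the reflection fixes.\<close>

lemma moment_odd:
  assumes "i < D" "j < D" "k < D" "l < D" "j \<noteq> i"
  shows "i \<noteq> k \<Longrightarrow> i \<noteq> l \<Longrightarrow> moment i j k l = 0" and "moment i i i j = 0"
proof -
  have flip: "reflect_coords j i 1 0 v k = (if k = i then - v i else v k)" for v k
    using assms by (simp add: reflect_coords_def)
  have "moment i j k l = - moment i j k l" if "i \<noteq> k" "i \<noteq> l"
    using reflect[of j i 1 0 i j k l] that assms by (simp add: moment_def flip)
  then show "i \<noteq> k \<Longrightarrow> i \<noteq> l \<Longrightarrow> moment i j k l = 0" by simp
  have "moment i i i j = - moment i i i j"
    using reflect[of j i 1 0 i i i j] assms by (simp add: moment_def reflect_coords_def)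
  then show "moment i i i j = 0" by simp
qed

lemma moment_swap:
  assumes "i < D" "k < D"
  shows "moment k k k k = moment i i i i"
proof (cases "i = k")
  case False
  then show ?thesis
    using reflect[of i k 0 1 k k k k] assms by (simp add: moment_def reflect_coords_def)
qed simp

text \<open>The reflection with \<open>p = q = 1 / sqrt 2\<close> maps the coordinate \<open>i\<close> to
  \<open>(u\<^sub>i + u\<^sub>k) / sqrt 2\<close>.\<close>

lemma moment_fourth_eq_mixed:
  assumes "i < D" "k < D" "i \<noteq> k"
  shows "moment i i i i = 3 * moment i i k k"
proof -
  define s where "s = 1 / sqrt 2"
  have s2: "s\<^sup>2 = 1 / 2" by (simp add: s_def power_divide)
  have "s ^ 4 = (s\<^sup>2)\<^sup>2" by (simp flip: power_mult)
  then have s4: "s ^ 4 = 1 / 4" unfolding s2 by (simp add: power2_eq_square)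
  note int = integrable_quartic
  have "moment i i i i = expectation (\<lambda>x. (s * u x i + s * u x k) ^ 4)"
    using reflect[of i k s s i i i i] assms s2
    by (simp add: moment_def reflect_coords_def power4_eq_xxxx)
  also have "\<dots> = expectation (\<lambda>x. s ^ 4 * (u x i * u x i * u x i * u x i
      + 4 * (u x i * u x i * u x i * u x k) + 6 * (u x i * u x i * u x k * u x k)
      + 4 * (u x k * u x k * u x k * u x i) + u x k * u x k * u x k * u x k))"
    by (rule Bochner_Integration.integral_cong) (auto simp: power4_eq_xxxx algebra_simps)
  also have "\<dots> = s ^ 4 * (moment i i i i + 4 * moment i i i k + 6 * moment i i k k
      + 4 * moment k k k i + moment k k k k)"
    using assms by (simp add: moment_def int)
  \<comment> \<open>The terms of odd degree vanish and the two pure moments agree. With M pure and X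
    mixed this reads M = (2 M + 6 X) / 4, that is M = 3 X.\<close>
  also have "\<dots> = (2 * moment i i i i + 6 * moment i i k k) / 4"
    using assms moment_odd(2)[of i k k k] moment_odd(2)[of k i i i] moment_swap[of i k] s4 by simp
  finally show ?thesis by simp
qed

text \<open>Normalisation fixes the value: squaring the norm identity gives D pure moments M and D
  (D - 1) mixed moments M / 3, which add up to M D (D + 2) / 3 = 1.\<close>

lemma moment_fourth:
  assumes "i < D"
  shows "moment i i i i = 3 / (real D * (real D + 2))"
proof -
  have mixed: "moment j j k k = moment i i i i * (if k = j then 1 else 1 / 3)" if "j < D" "k < D" for j k
    using moment_fourth_eq_mixed[of j k] moment_swap[of j i] that assms by auto
  have "1 = expectation (\<lambda>x. (\<Sum>j<D. (u x j)\<^sup>2) * (\<Sum>k<D. (u x k)\<^sup>2))"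
    by (subst Bochner_Integration.integral_cong[OF refl, of _ _ "\<lambda>_. 1"]) (auto simp: unit prob_space)
  also have "\<dots> = expectation (\<lambda>x. \<Sum>j<D. \<Sum>k<D. u x j * u x j * u x k * u x k)"
    by (simp add: sum_product power2_eq_square mult.assoc)
  also have "\<dots> = (\<Sum>j<D. \<Sum>k<D. moment j j k k)"
  proof -
    have "expectation (\<lambda>x. \<Sum>j<D. \<Sum>k<D. u x j * u x j * u x k * u x k) =
        (\<Sum>j<D. expectation (\<lambda>x. \<Sum>k<D. u x j * u x j * u x k * u x k))"
      by (intro Bochner_Integration.integral_sum Bochner_Integration.integrable_sum
          integrable_quartic) auto
    also have "\<dots> = (\<Sum>j<D. \<Sum>k<D. expectation (\<lambda>x. u x j * u x j * u x k * u x k))"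
      by (intro sum.cong refl Bochner_Integration.integral_sum integrable_quartic) auto
    finally show ?thesis by (simp add: moment_def)
  qed
  also have "\<dots> = (\<Sum>j<D. \<Sum>k<D. moment i i i i * (1 / 3 + 2 / 3 * of_bool (k = j)))"
    by (intro sum.cong refl) (auto simp: mixed)
  also have "\<dots> = moment i i i i * (\<Sum>j<D. real D / 3 + 2 / 3)"
  proof -
    have "(\<Sum>k<D. of_bool (k = j)) = (1 :: real)" if "j < D" for j
      using that by (simp add: of_bool_def)
    then have "(\<Sum>k<D. 1 / 3 + 2 / 3 * of_bool (k = j)) = real D / 3 + 2 / 3" if "j < D" for j
      using that by (simp add: sum.distrib flip: sum_distrib_left sum_divide_distrib)
    then show ?thesis by (simp flip: sum_distrib_left)
  qed
  also have "\<dots> = moment i i i i * (real D * (real D + 2)) / 3" by (simp add: algebra_simps)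
  finally have "moment i i i i * (real D * (real D + 2)) = 3" by simp
  moreover have "real D * (real D + 2) \<noteq> 0" using dim by auto
  ultimately show ?thesis by (metis eq_divide_eq)
qed

text \<open>Either some index differs from the other three and the moment vanishes, or the indices
  match in pairs. If all four agree, all three indicators hold, which accounts for the factor 3
  between pure and mixed moments.\<close>

lemma moment_eq:
  assumes "i < D" "j < D" "k < D" "l < D"
  shows "moment i j k l = (of_bool (i = j \<and> k = l) + of_bool (i = k \<and> j = l)
    + of_bool (i = l \<and> j = k)) / (real D * (real D + 2))"
proof -
  have pair: "moment i i k k = (if i = k then 3 else 1) / (real D * (real D + 2))"
    if "i < D" "k < D" for i k
    using moment_fourth[of i] moment_fourth_eq_mixed[of i k] that by auto
  have odd: "moment i j k l = 0" if "i < D" "j < D" "k < D" "l < D" "i \<noteq> j" "i \<noteq> k" "i \<noteq> l" for i j k l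
    using moment_odd(1)[of i j k l] that by simp
  have jikl: "moment i j k l = moment j i k l" by (simp add: moment_def mult_ac)
  consider "i \<noteq> j" "i \<noteq> k" "i \<noteq> l" | "j \<noteq> i" "j \<noteq> k" "j \<noteq> l" | "k \<noteq> i" "k \<noteq> j" "k \<noteq> l"
    | "l \<noteq> i" "l \<noteq> j" "l \<noteq> k" | "i = j" "k = l" | "i = k" "j = l" | "i = l" "j = k" by (smt (verit))
  then show ?thesis
  proof cases
    case 1 then show ?thesis using odd[of i j k l] assms by auto
  next
    case 2 then show ?thesis using odd[of j i k l] assms jikl by auto
  next
    case 3
    have "moment i j k l = moment k i j l" by (simp add: moment_def mult_ac)
    with 3 show ?thesis using odd[of k i j l] assms by auto
  next
    case 4
    have "moment i j k l = moment l i j k" by (simp add: moment_def mult_ac)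
    with 4 show ?thesis using odd[of l i j k] assms by auto
  next
    case 5 then show ?thesis using pair[of i k] assms by auto
  next
    case 6
    have "moment i j i j = moment i i j j" by (simp add: moment_def mult_ac)
    with 6 show ?thesis using pair[of i j] assms by auto
  next
    case 7
    have "moment i j j i = moment i i j j" by (simp add: moment_def mult_ac)
    with 7 show ?thesis using pair[of i j] assms by auto
  qed
qed
end

section \<open>Restriction to blocks of qubits\<close>

lemma restrict_qubits_less: "restrict_qubits qs x < 2 ^ length qs"
  using horner_sum_of_bool_2_less[of "map (bit x) qs"] by (simp add: restrict_qubits_def)

lemma restrict_qubits_eq_iff:
  "restrict_qubits qs x = restrict_qubits qs y \<longleftrightarrow> (\<forall>q\<in>set qs. bit x q = bit y q)"
proof
  assume eq: "restrict_qubits qs x = restrict_qubits qs y"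
  show "\<forall>q\<in>set qs. bit x q = bit y q"
  proof
    fix q assume "q \<in> set qs"
    then obtain k where k: "k < length qs" "qs ! k = q" by (auto simp: in_set_conv_nth)
    have "bit (restrict_qubits qs x) k = bit (restrict_qubits qs y) k" using eq by simp
    then show "bit x q = bit y q" using k by (simp add: restrict_qubits_def bit_horner_sum_bit_iff)
  qed
next
  assume "\<forall>q\<in>set qs. bit x q = bit y q"
  then have "map (bit x) qs = map (bit y) qs" by auto
  then show "restrict_qubits qs x = restrict_qubits qs y" by (simp only: restrict_qubits_def)
qed

lemma restrict_qubits_0 [simp]: "restrict_qubits qs 0 = 0"
  by (induction qs) (simp_all add: restrict_qubits_def)

text \<open>Covering by lists of total length n forces each qubit to be listed exactly once. This
  form serves the two uses directly: covering makes restriction injective, the total length counts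
  its range.\<close>

definition partitions_qubits :: "nat \<Rightarrow> nat \<Rightarrow> (nat \<Rightarrow> nat list) \<Rightarrow> bool" where
  "partitions_qubits n r qs \<longleftrightarrow>
     (\<forall>q<n. \<exists>i<r. q \<in> set (qs i)) \<and> (\<Sum>i<r. length (qs i)) = n"

lemma restrict_qubits_all_eq_iff:
  assumes "partitions_qubits n r qs" "x < 2 ^ n" "y < 2 ^ n"
  shows "(\<forall>i<r. restrict_qubits (qs i) x = restrict_qubits (qs i) y) \<longleftrightarrow> x = y"
proof
  assume eq: "\<forall>i<r. restrict_qubits (qs i) x = restrict_qubits (qs i) y"
  have "bit x q = bit y q" for q
  proof (cases "q < n")
    case True
    then show ?thesis using eq assms(1) unfolding partitions_qubits_def restrict_qubits_eq_iff by blast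
  next
    case False
    have "take_bit n x = x" "take_bit n y = y" using assms by (simp_all add: take_bit_nat_eq_self)
    then show ?thesis using False by (metis bit_take_bit_iff)
  qed
  then show "x = y" by (simp add: bit_eq_iff)
qed simp

text \<open>Restriction is injective since the lists cover all qubits; it is onto by counting.\<close>

lemma bij_betw_restrict_qubits:
  assumes "partitions_qubits n r qs"
  shows "bij_betw (\<lambda>x. \<lambda>i\<in>{..<r}. restrict_qubits (qs i) x) {..<2 ^ n}
    (\<Pi>\<^sub>E i\<in>{..<r}. {..<2 ^ length (qs i)})"
proof -
  let ?f = "\<lambda>x. \<lambda>i\<in>{..<r}. restrict_qubits (qs i) x"
  let ?B = "\<Pi>\<^sub>E i\<in>{..<r}. {..<2 ^ length (qs i)} :: nat set"
  have inj: "inj_on ?f {..<2 ^ n}"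
  proof (rule inj_onI)
    fix x y assume xy: "x \<in> {..<2 ^ n}" "y \<in> {..<2 ^ n}" "?f x = ?f y"
    have "restrict_qubits (qs i) x = restrict_qubits (qs i) y" if "i < r" for i
      using fun_cong[OF xy(3), of i] that by simp
    with xy show "x = y" using restrict_qubits_all_eq_iff[OF assms] by auto
  qed
  have sub: "?f ` {..<2 ^ n} \<subseteq> ?B" by (simp add: image_subset_iff restrict_PiE_iff restrict_qubits_less)
  have fin: "finite ?B" by (intro finite_PiE) auto
  have "card ?B = 2 ^ n"
    using assms by (simp add: card_PiE partitions_qubits_def flip: power_sum)
  then have "?f ` {..<2 ^ n} = ?B"
    using card_subset_eq[OF fin sub] card_image[OF inj] by simp
  with inj show ?thesis by (simp add: bij_betw_def)
qed

text \<open>A basis state amounts to an independent choice of a local state for every block, so the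
  sum distributes over the product. This factorisation gives both the orthogonality of a layer and
  the splitting of the moment over patches.\<close>

lemma sum_prod_restrict_qubits:
  fixes F :: "nat \<Rightarrow> nat \<Rightarrow> 'a :: comm_semiring_1"
  assumes "partitions_qubits n r qs"
  shows "(\<Sum>x<2 ^ n. \<Prod>i<r. F i (restrict_qubits (qs i) x)) =
    (\<Prod>i<r. \<Sum>z<2 ^ length (qs i). F i z)"
proof -
  have "(\<Sum>x<2 ^ n. \<Prod>i<r. F i (restrict_qubits (qs i) x)) =
      (\<Sum>x<2 ^ n. (\<lambda>g. \<Prod>i<r. F i (g i)) (\<lambda>i\<in>{..<r}. restrict_qubits (qs i) x))"
    by (intro sum.cong prod.cong) auto
  also have "\<dots> = (\<Sum>g\<in>(\<Pi>\<^sub>E i\<in>{..<r}. {..<2 ^ length (qs i)}). \<Prod>i<r. F i (g i))"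
    by (rule sum.reindex_bij_betw[OF bij_betw_restrict_qubits[OF assms]])
  also have "\<dots> = (\<Prod>i<r. \<Sum>z<2 ^ length (qs i). F i z)"
    by (subst prod_sum_PiE) auto
  finally show ?thesis .
qed

section \<open>Patches and superblocks as partitions of the qubits\<close>

lemma patch_simps:
  "set (patch \<xi> p) = {p * \<xi>..<(p + 1) * \<xi>}" "length (patch \<xi> p) = \<xi>"
  by (simp_all add: patch_def)

lemma in_own_patch: "0 < \<xi> \<Longrightarrow> q \<in> set (patch \<xi> (q div \<xi>))"
  by (simp add: patch_simps algebra_simps dividend_less_times_div)

lemma partitions_qubits_patch: "0 < \<xi> \<Longrightarrow> partitions_qubits (m * \<xi>) m (patch \<xi>)"
  unfolding partitions_qubits_def patch_simps(2)
  by (intro conjI allI impI) (auto intro: in_own_patch less_mult_imp_div_less exI[of _ "_ div \<xi>"])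

lemma partitions_qubits_first_layer:
  assumes "0 < \<xi>" "even m"
  shows "partitions_qubits (m * \<xi>) (m div 2) (first_layer_qubits \<xi>)"
  unfolding partitions_qubits_def
proof (intro conjI allI impI)
  fix q assume "q < m * \<xi>"
  define p where "p = q div \<xi>"
  have p: "p < m" "q \<in> set (patch \<xi> p)"
    using \<open>q < m * \<xi>\<close> in_own_patch[OF assms(1), of q] by (auto simp: p_def less_mult_imp_div_less)
  then have "p div 2 < m div 2" "p = 2 * (p div 2) \<or> p = 2 * (p div 2) + 1"
    using assms(2) by (auto elim!: evenE)
  then show "\<exists>i<m div 2. q \<in> set (first_layer_qubits \<xi> i)"
    using p(2) by (metis Un_iff first_layer_qubits_def set_append)
qed (use assms in \<open>auto simp: first_layer_qubits_def patch_simps elim!: evenE\<close>)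

lemma partitions_qubits_second_layer:
  assumes "0 < \<xi>" "even m"
  shows "partitions_qubits (m * \<xi>) (m div 2) (second_layer_qubits m \<xi>)"
  unfolding partitions_qubits_def
proof (intro conjI allI impI)
  fix q assume "q < m * \<xi>"
  define p where "p = q div \<xi>"
  have p: "p < m" "q \<in> set (patch \<xi> p)"
    using \<open>q < m * \<xi>\<close> in_own_patch[OF assms(1), of q] by (auto simp: p_def less_mult_imp_div_less)
  obtain k where m: "m = 2 * k" using assms(2) by (auto elim: evenE)
  have "\<exists>i<k. p = 2 * i + 1 \<or> p = (2 * i + 2) mod m"
  proof (cases "odd p")
    case True
    then show ?thesis using p(1) m by (intro exI[of _ "p div 2"]) (auto elim!: oddE)
  next
    case False
    then obtain j where j: "p = 2 * j" by (auto elim: evenE)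
    show ?thesis
    proof (cases j)
      \<comment> \<open>Patch 0 is the wrapped-around second half of the last superblock, number k -
        1, because 2 (k - 1) + 2 = m is 0 modulo m.\<close>
      case 0
      have "2 * (k - 1) + 2 = m" using p(1) m by simp
      then show ?thesis using p(1) m j 0 by (intro exI[of _ "k - 1"]) simp
    next
      case (Suc i)
      then show ?thesis using p(1) m j by (intro exI[of _ i]) auto
    qed
  qed
  then show "\<exists>i<m div 2. q \<in> set (second_layer_qubits m \<xi> i)"
    using p(2) m by (auto simp: second_layer_qubits_def)
qed (use assms in \<open>auto simp: second_layer_qubits_def patch_simps elim!: evenE\<close>)

section \<open>Tensor layers and Haar measure\<close>

lemma tensor_layer_carrier: "tensor_layer n r qs U \<in> carrier_mat (2 ^ n) (2 ^ n)"
  by (simp add: tensor_layer_def)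

lemma tensor_layer_index:
  assumes "x < 2 ^ n" "y < 2 ^ n"
  shows "tensor_layer n r qs U $$ (x, y) =
    (\<Prod>i<r. U i $$ (restrict_qubits (qs i) x, restrict_qubits (qs i) y))"
  using assms by (simp add: tensor_layer_def)

text \<open>Each entry of the product factors over the blocks. Orthonormality of the rows of the
  factors leaves the condition that x and z agree on every block, which means x = z.\<close>

lemma tensor_layer_mult_transpose:
  assumes "partitions_qubits n r qs"
    and "\<And>i. i < r \<Longrightarrow> U i \<in> orthogonal_group (2 ^ length (qs i))"
  shows "tensor_layer n r qs U * transpose_mat (tensor_layer n r qs U) = 1\<^sub>m (2 ^ n)"
    (is "?T * _ = _")
proof (intro eq_matI)
  fix x z assume "x < dim_row (1\<^sub>m (2 ^ n))" "z < dim_col (1\<^sub>m (2 ^ n))"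
  then have xz: "x < 2 ^ n" "z < 2 ^ n" by auto
  have "(?T * transpose_mat ?T) $$ (x, z) = (\<Sum>y<2 ^ n. ?T $$ (x, y) * ?T $$ (z, y))"
    using xz tensor_layer_carrier[of n r qs U] by (simp add: scalar_prod_def lessThan_atLeast0)
  also have "\<dots> = (\<Sum>y<2 ^ n. \<Prod>i<r.
      U i $$ (restrict_qubits (qs i) x, restrict_qubits (qs i) y) *
      U i $$ (restrict_qubits (qs i) z, restrict_qubits (qs i) y))"
    using xz by (simp add: tensor_layer_index prod.distrib)
  also have "\<dots> = (\<Prod>i<r. \<Sum>w<2 ^ length (qs i).
      U i $$ (restrict_qubits (qs i) x, w) * U i $$ (restrict_qubits (qs i) z, w))"
    by (rule sum_prod_restrict_qubits[OF assms(1)])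
  also have "\<dots> = (\<Prod>i<r. of_bool (restrict_qubits (qs i) x = restrict_qubits (qs i) z))"
    using assms(2) by (intro prod.cong refl orthogonal_group_row) (auto simp: restrict_qubits_less)
  also have "\<dots> = of_bool (\<forall>i<r. restrict_qubits (qs i) x = restrict_qubits (qs i) z)"
    by (induction r) (auto simp: less_Suc_eq)
  also have "\<dots> = of_bool (x = z)"
    using restrict_qubits_all_eq_iff[OF assms(1) xz] by simp
  finally show "(?T * transpose_mat ?T) $$ (x, z) = 1\<^sub>m (2 ^ n) $$ (x, z)" using xz by simp
qed (use tensor_layer_carrier[of n r qs U] in auto)

lemma tensor_layer_transpose:
  assumes "\<And>i. i < r \<Longrightarrow> U i \<in> carrier_mat (2 ^ length (qs i)) (2 ^ length (qs i))"
  shows "transpose_mat (tensor_layer n r qs U) = tensor_layer n r qs (\<lambda>i. transpose_mat (U i))"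
proof -
  have "U i $$ (restrict_qubits (qs i) y, restrict_qubits (qs i) x) =
      transpose_mat (U i) $$ (restrict_qubits (qs i) x, restrict_qubits (qs i) y)"
    if "i < r" for i x y
    using assms[OF that] restrict_qubits_less[of "qs i" x] restrict_qubits_less[of "qs i" y] by auto
  then show ?thesis by (intro eq_matI) (auto simp: tensor_layer_def intro!: prod.cong)
qed

text \<open>The product in the other order comes from the same lemma, since the transpose of a layer
  is the layer of the transposed factors.\<close>

lemma tensor_layer_orthogonal:
  assumes "partitions_qubits n r qs"
    and U: "\<And>i. i < r \<Longrightarrow> U i \<in> orthogonal_group (2 ^ length (qs i))"
  shows "tensor_layer n r qs U \<in> orthogonal_group (2 ^ n)"
proof -
  let ?T = "tensor_layer n r qs U"
  have "transpose_mat ?T = tensor_layer n r qs (\<lambda>i. transpose_mat (U i))"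
    using U by (intro tensor_layer_transpose) (auto simp: orthogonal_group_def)
  then have "transpose_mat ?T * transpose_mat (transpose_mat ?T) = 1\<^sub>m (2 ^ n)"
    using tensor_layer_mult_transpose[OF assms(1), of "\<lambda>i. transpose_mat (U i)"]
      orthogonal_group_transpose U by simp
  then show ?thesis
    using tensor_layer_mult_transpose[OF assms] tensor_layer_carrier
    by (simp add: orthogonal_group_def)
qed

section \<open>Haar measure: invariance of integrals, and of rows and columns\<close>

lemma haar_orthogonalD:
  assumes "haar_orthogonal D H"
  shows "prob_space H" "space H = orthogonal_group D"
    "sets H = sets (orthogonal_borel D)"
    "\<And>i j. i < D \<Longrightarrow> j < D \<Longrightarrow> (\<lambda>A. A $$ (i, j)) \<in> borel_measurable H"
proof -
  have s: "sets H = sets (orthogonal_borel D)" using assms by (simp add: haar_orthogonal_def)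
  show "prob_space H" using assms by (simp add: haar_orthogonal_def)
  show "space H = orthogonal_group D"
    using sets_eq_imp_space_eq[OF s] by (simp add: space_orthogonal_borel)
  show "sets H = sets (orthogonal_borel D)" by (rule s)
  show "\<And>i j. i < D \<Longrightarrow> j < D \<Longrightarrow> (\<lambda>A. A $$ (i, j)) \<in> borel_measurable H"
    unfolding measurable_cong_sets[OF s refl] by (rule measurable_entry)
qed

lemma orthogonal_group_mult_index:
  assumes "A \<in> orthogonal_group D" "B \<in> orthogonal_group D" "i < D" "j < D"
  shows "(A * B) $$ (i, j) = (\<Sum>k<D. A $$ (i, k) * B $$ (k, j))"
proof -
  have "A \<in> carrier_mat D D" "B \<in> carrier_mat D D"
    using assms by (auto simp: orthogonal_group_def)
  then show ?thesis using assms by (simp add: scalar_prod_def lessThan_atLeast0)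
qed

lemma haar_integral_mult:
  fixes f :: "real mat \<Rightarrow> real"
  assumes H: "haar_orthogonal D H" and V: "V \<in> orthogonal_group D"
    and f: "f \<in> borel_measurable H"
  shows "(\<integral>A. f (V * A) \<partial>H) = (\<integral>A. f A \<partial>H)" "(\<integral>A. f (A * V) \<partial>H) = (\<integral>A. f A \<partial>H)"
proof -
  note D = haar_orthogonalD[OF H]
  have f': "f \<in> borel_measurable (orthogonal_borel D)"
    using f unfolding measurable_cong_sets[OF D(3) refl] .
  have inv: "distr H (orthogonal_borel D) (\<lambda>A. V * A) = H"
    "distr H (orthogonal_borel D) (\<lambda>A. A * V) = H"
    using H V by (auto simp: haar_orthogonal_def)
  have "(\<lambda>A. V * A) \<in> measurable H (orthogonal_borel D)"
  proof (rule measurable_into_orthogonal_borel)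
    fix i j assume "i < D" "j < D"
    then show "(\<lambda>A. (V * A) $$ (i, j)) \<in> borel_measurable H"
      using V D(4) by (subst measurable_cong[OF orthogonal_group_mult_index[of V D]]) (auto simp: D(2))
  qed (use D(2) V in \<open>auto intro: orthogonal_group_mult\<close>)
  from integral_distr[OF this f'] show "(\<integral>A. f (V * A) \<partial>H) = (\<integral>A. f A \<partial>H)"
    by (simp add: inv)
  have "(\<lambda>A. A * V) \<in> measurable H (orthogonal_borel D)"
  proof (rule measurable_into_orthogonal_borel)
    fix i j assume "i < D" "j < D"
    then show "(\<lambda>A. (A * V) $$ (i, j)) \<in> borel_measurable H"
      using V D(4) by (subst measurable_cong[OF orthogonal_group_mult_index[of _ D V]]) (auto simp: D(2))
  qed (use D(2) V in \<open>auto intro: orthogonal_group_mult\<close>)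
  from integral_distr[OF this f'] show "(\<integral>A. f (A * V) \<partial>H) = (\<integral>A. f A \<partial>H)"
    by (simp add: inv)
qed

text \<open>Left multiplication by a plane reflection applies \<open>reflect_coords\<close> to each
  column, so left invariance of the measure yields \<open>reflect\<close>.\<close>

lemma invariant_unit_vector_column:
  assumes H: "haar_orthogonal D H" and D: "2 \<le> D" and c: "c < D"
  shows "invariant_unit_vector H D (\<lambda>A i. A $$ (i, c))"
proof -
  note HD = haar_orthogonalD[OF H]
  interpret prob_space H by (rule HD(1))
  show ?thesis
  proof
    fix a b i j k l :: nat and p q :: real
    assume R: "a < D" "b < D" "a \<noteq> b" "p\<^sup>2 + q\<^sup>2 = 1" and ijkl: "i < D" "j < D" "k < D" "l < D"
    let ?R = "plane_reflection D a b p q"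
    have R': "?R \<in> orthogonal_group D" by (rule plane_reflection_orthogonal[OF R])
    have "(?R * A) $$ (i, c) = reflect_coords a b p q (\<lambda>i. A $$ (i, c)) i"
      if "A \<in> space H" "i < D" for A i
      using that R c orthogonal_group_mult_index[OF R', of A i c]
        plane_reflection_sum[of a D b i p q "\<lambda>k. A $$ (k, c)"] by (simp add: HD(2))
    then show "expectation (\<lambda>A. A $$ (i, c) * A $$ (j, c) * A $$ (k, c) * A $$ (l, c)) =
      expectation (\<lambda>A. reflect_coords a b p q (\<lambda>i. A $$ (i, c)) i *
        reflect_coords a b p q (\<lambda>i. A $$ (i, c)) j *
        reflect_coords a b p q (\<lambda>i. A $$ (i, c)) k * reflect_coords a b p q (\<lambda>i. A $$ (i, c)) l)"
      using ijkl c HD(4)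
      by (subst haar_integral_mult(1)[OF H R', symmetric])
        (auto intro!: borel_measurable_times Bochner_Integration.integral_cong)
  next
    fix A assume "A \<in> space H"
    then show "(\<Sum>i<D. (A $$ (i, c))\<^sup>2) = 1"
      using orthogonal_group_col[of A D c c] c by (simp add: HD(2) power2_eq_square)
  qed (use D c HD(4) in auto)
qed

text \<open>Right multiplication applies the transposed reflection to each row; as the reflection is
  symmetric, this is again \<open>reflect_coords\<close>.\<close>

lemma invariant_unit_vector_row:
  assumes H: "haar_orthogonal D H" and D: "2 \<le> D" and c: "c < D"
  shows "invariant_unit_vector H D (\<lambda>A i. A $$ (c, i))"
proof -
  note HD = haar_orthogonalD[OF H]
  interpret prob_space H by (rule HD(1))
  show ?thesis
  proof
    fix a b i j k l :: nat and p q :: real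
    assume R: "a < D" "b < D" "a \<noteq> b" "p\<^sup>2 + q\<^sup>2 = 1" and ijkl: "i < D" "j < D" "k < D" "l < D"
    let ?R = "plane_reflection D a b p q"
    have R': "?R \<in> orthogonal_group D" by (rule plane_reflection_orthogonal[OF R])
    have sym: "?R $$ (k, i) = ?R $$ (i, k)" if "i < D" "k < D" for i k
    proof -
      have "transpose_mat ?R $$ (i, k) = ?R $$ (k, i)"
        using R' that by (auto simp: orthogonal_group_def)
      then show ?thesis using plane_reflection_symmetric[OF R(3)] by simp
    qed
    have "(A * ?R) $$ (c, i) = reflect_coords a b p q (\<lambda>i. A $$ (c, i)) i"
      if "A \<in> space H" "i < D" for A i
      using that R c orthogonal_group_mult_index[OF _ R', of A c i]
        plane_reflection_sum[of a D b i p q "\<lambda>k. A $$ (c, k)"] by (simp add: HD(2) sym mult.commute)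
    then show "expectation (\<lambda>A. A $$ (c, i) * A $$ (c, j) * A $$ (c, k) * A $$ (c, l)) =
      expectation (\<lambda>A. reflect_coords a b p q (\<lambda>i. A $$ (c, i)) i *
        reflect_coords a b p q (\<lambda>i. A $$ (c, i)) j *
        reflect_coords a b p q (\<lambda>i. A $$ (c, i)) k * reflect_coords a b p q (\<lambda>i. A $$ (c, i)) l)"
      using ijkl c HD(4)
      by (subst haar_integral_mult(2)[OF H R', symmetric])
        (auto intro!: borel_measurable_times Bochner_Integration.integral_cong)
  next
    fix A assume "A \<in> space H"
    then show "(\<Sum>i<D. (A $$ (c, i))\<^sup>2) = 1"
      using orthogonal_group_row[of A D c c] c by (simp add: HD(2) power2_eq_square)
  qed (use D c HD(4) in auto)
qed

section \<open>Transfer matrix of the pairings\<close>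

text \<open>Numbering the pairings 0, 1, 2 turns a choice of one pairing per superblock into a
  function with values in \<open>{..<3}\<close>, a configuration of a three-state chain.\<close>

definition pairing :: "nat \<Rightarrow> nat \<Rightarrow> nat \<Rightarrow> nat \<Rightarrow> nat \<Rightarrow> real" where
  "pairing s i j k l = of_bool (if s = 0 then i = j \<and> k = l
     else if s = 1 then i = k \<and> j = l else i = l \<and> j = k)"

lemma sum_lessThan_3: "(\<Sum>s<3::nat. f s) = f 0 + f 1 + (f 2 :: 'a :: comm_monoid_add)"
  by (simp add: numeral_3_eq_3 numeral_2_eq_2)

lemma sum_PiE_insert:
  assumes "x \<notin> A"
  shows "(\<Sum>g\<in>PiE (insert x A) B. h g) = (\<Sum>y\<in>B x. \<Sum>g\<in>PiE A B. h (g(x := y)))"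
proof -
  have "(\<Sum>g\<in>PiE (insert x A) B. h g) = (\<Sum>(y, g)\<in>B x \<times> PiE A B. h (g(x := y)))"
    unfolding PiE_insert_eq
    by (subst sum.reindex[OF inj_combinator[OF assms]]) (auto intro!: sum.cong)
  then show ?thesis by (simp add: sum.cartesian_product)
qed

text \<open>The transfer matrix \<open>a I + b J\<close>, with \<open>J\<close> the all-ones matrix of size \<open>q\<close>, has the
  \<open>k\<close>-th power \<open>a\<^sup>k I + ((a + q b)\<^sup>k - a\<^sup>k) / q J\<close>.\<close>

lemma sum_open_chain:
  fixes a b :: real and f :: "nat \<Rightarrow> nat \<Rightarrow> real"
  assumes "0 < q"
  shows "(\<Sum>s\<in>PiE {..<Suc k} (\<lambda>_. {..<q}).
      (\<Prod>p<k. a * of_bool (s (Suc p) = s p) + b) * f (s 0) (s k)) =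
    (\<Sum>\<alpha><q. \<Sum>\<beta><q. (a ^ k * of_bool (\<alpha> = \<beta>) + ((a + real q * b) ^ k - a ^ k) / real q) * f \<alpha> \<beta>)"
\<comment> \<open>The weight f of the two end sites stays arbitrary: the bond to a new last site is
  absorbed into f, which leaves the shorter chain.\<close>
proof (induction k arbitrary: f)
  case 0
  have "{..<Suc 0} = insert 0 {}" by auto
  then have "(\<Sum>s\<in>PiE {..<Suc 0} (\<lambda>_. {..<q}). f (s 0) (s 0)) = (\<Sum>\<alpha><q. f \<alpha> \<alpha>)"
    by (simp only:) (subst sum_PiE_insert; simp)
  moreover have "(\<Sum>\<beta><q. of_bool (\<alpha> = \<beta>) * f \<alpha> \<beta>) = f \<alpha> \<alpha>" if "\<alpha> < q" for \<alpha>
    using that by (simp add: of_bool_def if_distrib[of "\<lambda>x. x * _"] cong: if_cong)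
  ultimately show ?case by simp
next
  case (Suc k)
  let ?P = "PiE {..<Suc k} (\<lambda>_. {..<q})"
  define c where "c = ((a + real q * b) ^ k - a ^ k) / real q"
  have ins: "{..<Suc (Suc k)} = insert (Suc k) {..<Suc k}" by auto
  have "(\<Sum>s\<in>PiE {..<Suc (Suc k)} (\<lambda>_. {..<q}).
      (\<Prod>p<Suc k. a * of_bool (s (Suc p) = s p) + b) * f (s 0) (s (Suc k))) =
      (\<Sum>v<q. \<Sum>s\<in>?P. (\<Prod>p<k. a * of_bool (s (Suc p) = s p) + b) *
        ((a * of_bool (v = s k) + b) * f (s 0) v))"
    unfolding ins by (subst sum_PiE_insert) (auto intro!: sum.cong prod.cong simp: mult.assoc)
  also have "\<dots> = (\<Sum>s\<in>?P. (\<Prod>p<k. a * of_bool (s (Suc p) = s p) + b) *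
        (\<Sum>v<q. (a * of_bool (v = s k) + b) * f (s 0) v))"
    by (subst sum.swap) (simp add: sum_distrib_left)
  also have "\<dots> = (\<Sum>\<alpha><q. \<Sum>\<beta><q. (a ^ k * of_bool (\<alpha> = \<beta>) + c) *
        (\<Sum>v<q. (a * of_bool (v = \<beta>) + b) * f \<alpha> v))"
    unfolding c_def by (rule Suc.IH)
  \<comment> \<open>The inner sum over the old end site is now an entry of the matrix product of the
    k-th power with one more transfer matrix.\<close>
  also have "\<dots> = (\<Sum>\<alpha><q. \<Sum>v<q. (\<Sum>\<beta><q. (a ^ k * of_bool (\<alpha> = \<beta>) + c) * (a * of_bool (v = \<beta>) + b)) * f \<alpha> v)"
    unfolding sum_distrib_left sum_distrib_right
    by (rule sum.cong[OF refl], rule trans[OF sum.swap]) (simp add: mult.assoc)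
  also have "\<dots> = (\<Sum>\<alpha><q. \<Sum>v<q. (a ^ Suc k * of_bool (\<alpha> = v)
      + ((a + real q * b) ^ Suc k - a ^ Suc k) / real q) * f \<alpha> v)"
  proof (intro sum.cong refl arg_cong2[where f = "(*)"])
    fix \<alpha> v assume "\<alpha> \<in> {..<q}" "v \<in> {..<q}"
    then have \<delta>: "(\<Sum>\<beta><q. of_bool (\<alpha> = \<beta>)) = (1::real)" "(\<Sum>\<beta><q. of_bool (v = \<beta>)) = (1::real)"
      by (auto simp: of_bool_def)
    have "(\<Sum>\<beta><q. of_bool (\<alpha> = \<beta> \<and> v = \<beta>)) = (\<Sum>\<beta><q. of_bool (\<alpha> = v) * of_bool (\<alpha> = \<beta>) :: real)"
      by (intro sum.cong) auto
    also have "\<dots> = of_bool (\<alpha> = v)" by (simp only: sum_distrib_left[symmetric] \<delta> mult_1_right)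
    finally have "(\<Sum>\<beta><q. of_bool (\<alpha> = \<beta> \<and> v = \<beta>)) = (of_bool (\<alpha> = v) :: real)" .
    note 1 = \<delta> this
    have "(\<Sum>\<beta><q. (a ^ k * of_bool (\<alpha> = \<beta>) + c) * (a * of_bool (v = \<beta>) + b)) =
      (\<Sum>\<beta><q. a ^ Suc k * of_bool (\<alpha> = \<beta> \<and> v = \<beta>) + a ^ k * b * of_bool (\<alpha> = \<beta>) + c * a * of_bool (v = \<beta>) + c * b)"
      by (intro sum.cong refl) (auto simp: algebra_simps)
    also have "\<dots> = a ^ Suc k * of_bool (\<alpha> = v) + a ^ k * b + c * a + real q * c * b"
      by (simp only: sum.distrib sum_distrib_left[symmetric] 1) simp
    also have "\<dots> = a ^ Suc k * of_bool (\<alpha> = v)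
      + ((a + real q * b) ^ Suc k - a ^ Suc k) / real q"
      using assms by (simp add: c_def field_simps)
    finally show "(\<Sum>\<beta><q. (a ^ k * of_bool (\<alpha> = \<beta>) + c) * (a * of_bool (v = \<beta>) + b)) =
      a ^ Suc k * of_bool (\<alpha> = v) + ((a + real q * b) ^ Suc k - a ^ Suc k) / real q" .
  qed
  finally show ?case .
qed

text \<open>Taking f to be the closing bond makes the sum the trace of the power Suc k of the
  transfer matrix, whose eigenvalues are a + q b once and a with multiplicity q - 1.\<close>

lemma sum_closed_chain:
  fixes a b :: real
  assumes "0 < q"
  shows "(\<Sum>s\<in>PiE {..<Suc k} (\<lambda>_. {..<q}).
      (\<Prod>p<k. a * of_bool (s (Suc p) = s p) + b) * (a * of_bool (s 0 = s k) + b)) =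
    (a + real q * b) ^ Suc k + (real q - 1) * a ^ Suc k"
proof -
  define c where "c = ((a + real q * b) ^ k - a ^ k) / real q"
  have "(\<Sum>\<beta><q. (a ^ k * of_bool (\<alpha> = \<beta>) + c) * (a * of_bool (\<alpha> = \<beta>) + b)) =
      a ^ Suc k + a ^ k * b + c * a + real q * c * b" if "\<alpha> < q" for \<alpha>
  proof -
    have 1: "(\<Sum>\<beta><q. of_bool (\<alpha> = \<beta>)) = (1::real)"
      using that by (auto simp: of_bool_def)
    have "(\<Sum>\<beta><q. (a ^ k * of_bool (\<alpha> = \<beta>) + c) * (a * of_bool (\<alpha> = \<beta>) + b)) =
        (\<Sum>\<beta><q. (a ^ Suc k + a ^ k * b + c * a) * of_bool (\<alpha> = \<beta>) + c * b)"
      by (intro sum.cong refl) (auto simp: algebra_simps)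
    also have "\<dots> = a ^ Suc k + a ^ k * b + c * a + real q * c * b"
      by (simp only: sum.distrib sum_distrib_left[symmetric] 1) simp
    finally show ?thesis .
  qed
  then have "(\<Sum>s\<in>PiE {..<Suc k} (\<lambda>_. {..<q}).
      (\<Prod>p<k. a * of_bool (s (Suc p) = s p) + b) * (a * of_bool (s 0 = s k) + b)) =
      real q * (a ^ Suc k + a ^ k * b + c * a + real q * c * b)"
    using sum_open_chain[OF assms, where k = k and a = a and b = b
        and f = "\<lambda>\<alpha> \<beta>. a * of_bool (\<alpha> = \<beta>) + b"] by (simp add: c_def)
  also have "\<dots> = (a + real q * b) ^ Suc k + (real q - 1) * a ^ Suc k"
    using assms by (simp add: c_def field_simps)
  finally show ?thesis .
qed

text \<open>Two pairings of four replicas glue to two loops if they agree and to one loop otherwise.\<close>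

lemma sum_pairing_mult_pairing:
  assumes "s < 3" "t < 3"
  shows "(\<Sum>i<d. \<Sum>j<d. \<Sum>k<d. \<Sum>l<d. pairing s i j k l * pairing t i j k l) =
    (real d ^ 2 - real d) * of_bool (s = t) + real d"
proof -
  \<comment> \<open>Simplification turns sums of indicators over \<open>{..<d}\<close> into
    cardinalities of intersections with singletons; all of these are 1 in the range of
    summation.\<close>
  have "(\<Sum>k<d. real (card ({..<d} \<inter> {k}))) = (\<Sum>k<d. 1)"
    "(\<Sum>k<d. real (card ({..<d} \<inter> {k})) * (real (card ({..<d} \<inter> {k})) * real (card ({..<d} \<inter> {k}))))
      = (\<Sum>k<d. 1)"
    by (intro sum.cong; simp)+
  then have diagonal: "(\<Sum>k<d. real (card ({..<d} \<inter> {k}))) = real d"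
    "(\<Sum>k<d. real (card ({..<d} \<inter> {k})) * (real (card ({..<d} \<inter> {k})) * real (card ({..<d} \<inter> {k}))))
      = real d"
    by simp_all
  have equal: "(\<Sum>i<d. \<Sum>j<d. \<Sum>k<d. \<Sum>l<d. of_bool (j = i) * (of_bool (l = k) * 1)) = (real d)\<^sup>2"
    "(\<Sum>i<d. \<Sum>j<d. \<Sum>k<d. \<Sum>l<d. of_bool (k = i) * (of_bool (l = j) * 1)) = (real d)\<^sup>2"
    "(\<Sum>i<d. \<Sum>j<d. \<Sum>k<d. \<Sum>l<d. of_bool (k = j) * (of_bool (l = i) * 1)) = (real d)\<^sup>2"
    by (simp_all add: diagonal power2_eq_square cong: sum.cong flip: sum_distrib_left sum_distrib_right)
  have distinct: "(\<Sum>i<d. \<Sum>j<d. \<Sum>k<d. \<Sum>l<d. of_bool (j = i) * (of_bool (k = i) * of_bool (l = i))) = real d"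
    by (simp add: diagonal cong: sum.cong flip: sum_distrib_left)
  \<comment> \<open>Two different pairings force all four indices to be equal, so all mixed products
    are the same indicator.\<close>
  have product: "pairing s i j k l * pairing t i j k l =
      (if s = t then if s = 0 then of_bool (j = i) * (of_bool (l = k) * 1)
         else if s = 1 then of_bool (k = i) * (of_bool (l = j) * 1)
         else of_bool (k = j) * (of_bool (l = i) * 1)
       else of_bool (j = i) * (of_bool (k = i) * of_bool (l = i)))" for i j k l
  proof -
    have "s = 0 \<or> s = 1 \<or> s = 2" "t = 0 \<or> t = 1 \<or> t = 2" using assms by auto
    then show ?thesis by (elim disjE) (auto simp: pairing_def)
  qed
  have "(\<Sum>i<d. \<Sum>j<d. \<Sum>k<d. \<Sum>l<d. pairing s i j k l * pairing t i j k l) =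
      (if s = t then (real d)\<^sup>2 else real d)"
    unfolding product
    by (cases "s = t"; cases "s = 0"; cases "s = 1";
        simp only: if_True if_False equal distinct simp_thms zero_neq_one one_neq_zero)
  then show ?thesis by simp
qed

section \<open>The fourth moment of the two-layer circuit\<close>

abbreviation superblocks :: "nat \<Rightarrow> (nat \<times> nat) set" where
  "superblocks m \<equiv> {0, 1} \<times> {..<m div 2}"

definition layer_qubits :: "nat \<Rightarrow> nat \<Rightarrow> nat \<times> nat \<Rightarrow> nat list" where
  "layer_qubits m \<xi> j =
     (if fst j = 0 then first_layer_qubits \<xi> (snd j) else second_layer_qubits m \<xi> (snd j))"

text \<open>The entry of superblock \<open>j\<close> on the path from basis state \<open>z\<close> through \<open>y\<close> to \<open>x\<close>.\<close>

definition path_factor :: "nat \<Rightarrow> nat \<Rightarrow> nat \<Rightarrow> nat \<Rightarrow> nat \<Rightarrow> nat \<times> nat \<Rightarrow> real mat \<Rightarrow> real" where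
  "path_factor m \<xi> x y z j A =
     (let r = restrict_qubits (layer_qubits m \<xi> j) in
      if fst j = 0 then A $$ (r y, r z) else A $$ (r x, r y))"

lemma restrict_layer_qubits_less: "restrict_qubits (layer_qubits m \<xi> j) y < 2 ^ (2 * \<xi>)"
  using restrict_qubits_less[of "layer_qubits m \<xi> j" y]
  by (simp add: layer_qubits_def first_layer_qubits_def second_layer_qubits_def patch_simps mult_2
      split: if_splits)

lemma prod_two_layers:
  fixes f :: "nat \<times> nat \<Rightarrow> 'a :: comm_monoid_mult"
  shows "(\<Prod>j\<in>{0, 1} \<times> {..<k}. f j) = (\<Prod>i<k. f (0, i)) * (\<Prod>i<k. f (1, i))"
proof -
  have "(\<Prod>j\<in>{0, 1} \<times> {..<k}. f j) = (\<Prod>l\<in>{0, 1}. \<Prod>i<k. f (l, i))"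
    by (simp add: prod.cartesian_product del: prod.insert)
  then show ?thesis by simp
qed

text \<open>The matrix product sums over the basis state y between the layers. On a fixed path every
  superblock contributes exactly one entry, which prepares the use of independence.\<close>

lemma two_layer_circuit_index:
  assumes "x < 2 ^ (m * \<xi>)" "z < 2 ^ (m * \<xi>)"
  shows "two_layer_circuit m \<xi> U $$ (x, z) =
    (\<Sum>y<2 ^ (m * \<xi>). \<Prod>j\<in>superblocks m. path_factor m \<xi> x y z j (U j))"
proof -
  let ?N = "2 ^ (m * \<xi>) :: nat"
  let ?S = "tensor_layer (m * \<xi>) (m div 2) (second_layer_qubits m \<xi>) (\<lambda>i. U (1, i))"
  let ?F = "tensor_layer (m * \<xi>) (m div 2) (first_layer_qubits \<xi>) (\<lambda>i. U (0, i))"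
  have "two_layer_circuit m \<xi> U $$ (x, z) = (\<Sum>y<?N. ?S $$ (x, y) * ?F $$ (y, z))"
    unfolding two_layer_circuit_def using assms tensor_layer_carrier[of "m * \<xi>" "m div 2"]
    by (simp add: scalar_prod_def lessThan_atLeast0 index_mult_mat carrier_matD[OF tensor_layer_carrier])
  also have "\<dots> = (\<Sum>y<?N. \<Prod>j\<in>superblocks m. path_factor m \<xi> x y z j (U j))"
    using assms
    unfolding prod_two_layers
    by (intro sum.cong refl) (simp add: tensor_layer_index path_factor_def layer_qubits_def Let_def mult.commute)
  finally show ?thesis .
qed

lemma path_factor_measurable:
  assumes "haar_orthogonal (2 ^ (2 * \<xi>)) H"
  shows "path_factor m \<xi> x y z j \<in> borel_measurable H"
proof -
  have "path_factor m \<xi> x y z j = (\<lambda>A. A $$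
      (if fst j = 0 then (restrict_qubits (layer_qubits m \<xi> j) y, restrict_qubits (layer_qubits m \<xi> j) z)
       else (restrict_qubits (layer_qubits m \<xi> j) x, restrict_qubits (layer_qubits m \<xi> j) y)))"
    by (auto simp: path_factor_def Let_def)
  then show ?thesis
    using haar_orthogonalD(4)[OF assms] restrict_layer_qubits_less by auto
qed

lemma path_factor_bound:
  assumes "A \<in> orthogonal_group (2 ^ (2 * \<xi>))"
  shows "\<bar>path_factor m \<xi> x y z j A\<bar> \<le> 1"
  using orthogonal_group_entry_bound[OF assms] restrict_layer_qubits_less
  by (auto simp: path_factor_def Let_def)

lemma two_layer_circuit_orthogonal:
  assumes "0 < \<xi>" "even m"
    and "\<And>j. j \<in> superblocks m \<Longrightarrow> U j \<in> orthogonal_group (2 ^ (2 * \<xi>))"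
  shows "two_layer_circuit m \<xi> U \<in> orthogonal_group (2 ^ (m * \<xi>))"
  unfolding two_layer_circuit_def using assms
  by (intro orthogonal_group_mult tensor_layer_orthogonal partitions_qubits_first_layer
      partitions_qubits_second_layer)
    (auto simp: first_layer_qubits_def second_layer_qubits_def patch_simps mult_2)

lemma measurable_two_layer_circuit:
  assumes H: "haar_orthogonal (2 ^ (2 * \<xi>)) H" and "0 < \<xi>" "even m"
  shows "two_layer_circuit m \<xi> \<in>
    measurable (\<Pi>\<^sub>M j\<in>superblocks m. H) (orthogonal_borel (2 ^ (m * \<xi>)))"
proof (rule measurable_into_orthogonal_borel)
  fix U assume "U \<in> space (\<Pi>\<^sub>M j\<in>superblocks m. H)"
  then show "two_layer_circuit m \<xi> U \<in> orthogonal_group (2 ^ (m * \<xi>))"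
    using assms haar_orthogonalD(2)[OF H]
    by (intro two_layer_circuit_orthogonal) (auto simp: space_PiM PiE_iff)
next
  fix x z :: nat assume xz: "x < 2 ^ (m * \<xi>)" "z < 2 ^ (m * \<xi>)"
  have "(\<lambda>U. path_factor m \<xi> x y z j (U j)) \<in> borel_measurable (\<Pi>\<^sub>M j\<in>superblocks m. H)"
    if "j \<in> superblocks m" for y j
    by (rule measurable_compose[OF measurable_component_singleton[OF that] path_factor_measurable[OF H]])
  then show "(\<lambda>U. two_layer_circuit m \<xi> U $$ (x, z)) \<in> borel_measurable (\<Pi>\<^sub>M j\<in>superblocks m. H)"
    unfolding two_layer_circuit_index[OF xz] by (intro borel_measurable_sum borel_measurable_prod)
qed

section \<open>Four replicas on the ring of patches\<close>

abbreviation replica_pairing :: "nat \<Rightarrow> nat list \<Rightarrow> nat \<Rightarrow> nat \<Rightarrow> nat \<Rightarrow> nat \<Rightarrow> real" where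
  "replica_pairing s qs x y z w \<equiv> pairing s (restrict_qubits qs x) (restrict_qubits qs y)
     (restrict_qubits qs z) (restrict_qubits qs w)"

text \<open>Two basis states agree on a superblock exactly if they agree on both of its patches, so
  the pairing of a superblock imposes the same pairing on each patch.\<close>

lemma replica_pairing_append:
  "replica_pairing s (qs @ qs') x y z w = replica_pairing s qs x y z w * replica_pairing s qs' x y z w"
proof -
  have "restrict_qubits (qs @ qs') a = restrict_qubits (qs @ qs') b \<longleftrightarrow>
      restrict_qubits qs a = restrict_qubits qs b \<and> restrict_qubits qs' a = restrict_qubits qs' b" for a b
    by (simp add: restrict_qubits_eq_iff ball_Un)
  then show ?thesis by (simp add: pairing_def conj_ac flip: of_bool_conj)
qed

text \<open>All paths start and end in state 0, so a superblock of the first layer enters through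
  its column 0 and one of the second layer through its row 0. Both are invariant unit
  vectors.\<close>

lemma path_factor_fourth_moment:
  assumes H: "haar_orthogonal (2 ^ (2 * \<xi>)) H" and "0 < \<xi>"
  shows "(\<integral>A. path_factor m \<xi> 0 x 0 j A * path_factor m \<xi> 0 y 0 j A *
      path_factor m \<xi> 0 z 0 j A * path_factor m \<xi> 0 w 0 j A \<partial>H) =
    (\<Sum>s<3. replica_pairing s (layer_qubits m \<xi> j) x y z w) / (2 ^ (2 * \<xi>) * (2 ^ (2 * \<xi>) + 2))"
proof -
  have D: "2 \<le> (2::nat) ^ (2 * \<xi>)" using \<open>0 < \<xi>\<close> power_increasing[of 1 "2 * \<xi>" "2::nat"] by simp
  interpret col: invariant_unit_vector H "2 ^ (2 * \<xi>)" "\<lambda>A i. A $$ (i, 0)"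
    by (rule invariant_unit_vector_column[OF H D]) simp
  interpret row: invariant_unit_vector H "2 ^ (2 * \<xi>)" "\<lambda>A i. A $$ (0, i)"
    by (rule invariant_unit_vector_row[OF H D]) simp
  note r = restrict_layer_qubits_less[of m \<xi> j]
  have pairings: "of_bool (a = b \<and> c = e) + of_bool (a = c \<and> b = e) + of_bool (a = e \<and> b = c) =
      (\<Sum>s<3. pairing s a b c e)" for a b c e
    by (simp add: sum_lessThan_3 pairing_def)
  show ?thesis
  proof (cases "fst j = 0")
    case True
    then show ?thesis
      using col.moment_eq[OF r r r r, of x y z w]
      by (simp only: path_factor_def Let_def if_True restrict_qubits_0 col.moment_def pairings
          of_nat_power of_nat_numeral simp_thms)
  next
    case False
    then show ?thesis
      using row.moment_eq[OF r r r r, of x y z w]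
      by (simp only: path_factor_def Let_def if_False restrict_qubits_0 row.moment_def pairings
          of_nat_power of_nat_numeral simp_thms)
  qed
qed

lemma prod_even_odd: "(\<Prod>p<2 * k. g p) = (\<Prod>i<k. g (2 * i)) * (\<Prod>i<k. g (2 * i + 1) :: 'a :: comm_monoid_mult)"
  for k :: nat
  by (induction k) (simp_all add: mult_ac)

text \<open>The two layers together hold one superblock for each pair of cyclic neighbours p, p + 1:
  even p come from the first layer, odd p from the second.\<close>

lemma prod_layer_qubits:
  fixes f :: "nat list \<Rightarrow> 'a :: comm_monoid_mult"
  assumes "even m"
  shows "(\<Prod>j\<in>superblocks m. f (layer_qubits m \<xi> j)) =
    (\<Prod>p<m. f (patch \<xi> p @ patch \<xi> ((p + 1) mod m)))"
proof -
  obtain k where m: "m = 2 * k" using assms by (auto elim: evenE)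
  have "(\<Prod>p<m. f (patch \<xi> p @ patch \<xi> ((p + 1) mod m))) =
      (\<Prod>i<k. f (patch \<xi> (2 * i) @ patch \<xi> (2 * i + 1))) *
      (\<Prod>i<k. f (patch \<xi> (2 * i + 1) @ patch \<xi> ((2 * i + 2) mod m)))"
    unfolding m prod_even_odd by (intro arg_cong2[where f = "(*)"] prod.cong refl) auto
  then show ?thesis
    unfolding prod_two_layers by (simp add: m layer_qubits_def first_layer_qubits_def second_layer_qubits_def)
qed

lemma sum_power4:
  fixes f :: "'a \<Rightarrow> 'b :: comm_semiring_1"
  shows "(\<Sum>y\<in>S. f y) ^ 4 = (\<Sum>x\<in>S. \<Sum>y\<in>S. \<Sum>z\<in>S. \<Sum>w\<in>S. f x * f y * f z * f w)"
  by (simp add: power4_eq_xxxx flip: sum_distrib_left sum_distrib_right)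

text \<open>The fourth power yields four independent intermediate states x, y, z, w. For fixed
  states the integrand is a product of functions of single superblocks, so its expectation under the
  product measure factors.\<close>

lemma two_layer_fourth_moment_expand:
  assumes H: "haar_orthogonal (2 ^ (2 * \<xi>)) H" and "0 < \<xi>" "even m"
  shows "(\<integral>A. \<bar>A $$ (0, 0)\<bar> ^ 4 \<partial>two_layer_ensemble m \<xi> H) =
    (\<Sum>x<2 ^ (m * \<xi>). \<Sum>y<2 ^ (m * \<xi>). \<Sum>z<2 ^ (m * \<xi>). \<Sum>w<2 ^ (m * \<xi>).
      \<Prod>p<m. (\<Sum>s<3. replica_pairing s (patch \<xi> p @ patch \<xi> ((p + 1) mod m)) x y z w) /
        (2 ^ (2 * \<xi>) * (2 ^ (2 * \<xi>) + 2)))"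
proof -
  let ?N = "2 ^ (m * \<xi>) :: nat"
  interpret H: prob_space H by (rule haar_orthogonalD(1)[OF H])
  interpret product_sigma_finite "\<lambda>_. H" by standard
  define F where "F x y z w j A = path_factor m \<xi> 0 x 0 j A * path_factor m \<xi> 0 y 0 j A *
      path_factor m \<xi> 0 z 0 j A * path_factor m \<xi> 0 w 0 j A" for x y z w j A
  have int: "integrable H (F x y z w j)" for x y z w j
  proof (rule H.integrable_const_bound)
    show "AE A in H. norm (F x y z w j A) \<le> 1"
      unfolding F_def using haar_orthogonalD(2)[OF H]
      by (auto simp: abs_mult intro!: mult_le_one path_factor_bound)
    show "F x y z w j \<in> borel_measurable H"
      unfolding F_def by (intro borel_measurable_times path_factor_measurable[OF H])
  qed
  have int_prod: "integrable (\<Pi>\<^sub>M j\<in>superblocks m. H) (\<lambda>U. \<Prod>j\<in>superblocks m. F x y z w j (U j))" for x y z w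
    by (intro product_integrable_prod int) auto
  have "(\<integral>A. \<bar>A $$ (0, 0)\<bar> ^ 4 \<partial>two_layer_ensemble m \<xi> H) =
      (\<integral>U. \<bar>two_layer_circuit m \<xi> U $$ (0, 0)\<bar> ^ 4 \<partial>(\<Pi>\<^sub>M j\<in>superblocks m. H))"
    unfolding two_layer_ensemble_def
    by (intro integral_distr measurable_two_layer_circuit[OF H] assms borel_measurable_power
        borel_measurable_abs measurable_entry) auto
  also have "\<dots> = (\<integral>U. (\<Sum>x<?N. \<Sum>y<?N. \<Sum>z<?N. \<Sum>w<?N. \<Prod>j\<in>superblocks m. F x y z w j (U j)) \<partial>(\<Pi>\<^sub>M j\<in>superblocks m. H))"
    by (simp only: power_even_abs_numeral even_numeral two_layer_circuit_index zero_less_power zero_less_numeral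
        sum_power4 F_def prod.distrib)
  also have "\<dots> = (\<Sum>x<?N. \<Sum>y<?N. \<Sum>z<?N. \<Sum>w<?N. \<integral>U. (\<Prod>j\<in>superblocks m. F x y z w j (U j)) \<partial>(\<Pi>\<^sub>M j\<in>superblocks m. H))"
    by (simp only: Bochner_Integration.integral_sum Bochner_Integration.integrable_sum int_prod)
  also have "\<dots> = (\<Sum>x<?N. \<Sum>y<?N. \<Sum>z<?N. \<Sum>w<?N. \<Prod>j\<in>superblocks m. integral\<^sup>L H (F x y z w j))"
    by (intro sum.cong refl product_integral_prod int) auto
  finally show ?thesis
    unfolding F_def path_factor_fourth_moment[OF H \<open>0 < \<xi>\<close>]
    by (simp only: prod_layer_qubits[OF \<open>even m\<close>,
        of "\<lambda>qs. (\<Sum>s<3. replica_pairing s qs _ _ _ _) / (2 ^ (2 * \<xi>) * (2 ^ (2 * \<xi>) + 2))"])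
qed

text \<open>The single-replica factorisation is applied from the innermost sum outwards, with the
  local states of the remaining replicas as parameters.\<close>

lemma sum_prod_restrict_qubits4:
  fixes F :: "nat \<Rightarrow> nat \<Rightarrow> nat \<Rightarrow> nat \<Rightarrow> nat \<Rightarrow> 'a :: comm_semiring_1"
  assumes P: "partitions_qubits n r qs"
  defines "R \<equiv> \<lambda>i. restrict_qubits (qs i)" and "L \<equiv> \<lambda>i. 2 ^ length (qs i)"
  shows "(\<Sum>x<2 ^ n. \<Sum>y<2 ^ n. \<Sum>z<2 ^ n. \<Sum>w<2 ^ n. \<Prod>i<r. F i (R i x) (R i y) (R i z) (R i w)) =
    (\<Prod>i<r. \<Sum>a<L i. \<Sum>b<L i. \<Sum>c<L i. \<Sum>e<L i. F i a b c e)"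
proof -
  have *: "(\<Sum>x<2 ^ n. \<Prod>i<r. F i (R i x)) = (\<Prod>i<r. \<Sum>a<L i. F i a)"
    for F :: "nat \<Rightarrow> nat \<Rightarrow> 'a"
    unfolding R_def L_def by (rule sum_prod_restrict_qubits[OF P])
  have "(\<Sum>w<2 ^ n. \<Prod>i<r. F i (R i x) (R i y) (R i z) (R i w)) =
      (\<Prod>i<r. \<Sum>e<L i. F i (R i x) (R i y) (R i z) e)" for x y z
    by (rule *[where F = "\<lambda>i. F i (R i x) (R i y) (R i z)"])
  moreover have "(\<Sum>z<2 ^ n. \<Prod>i<r. \<Sum>e<L i. F i (R i x) (R i y) (R i z) e) =
      (\<Prod>i<r. \<Sum>c<L i. \<Sum>e<L i. F i (R i x) (R i y) c e)" for x y
    by (rule *[where F = "\<lambda>i c. \<Sum>e<L i. F i (R i x) (R i y) c e"])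
  moreover have "(\<Sum>y<2 ^ n. \<Prod>i<r. \<Sum>c<L i. \<Sum>e<L i. F i (R i x) (R i y) c e) =
      (\<Prod>i<r. \<Sum>b<L i. \<Sum>c<L i. \<Sum>e<L i. F i (R i x) b c e)" for x
    by (rule *[where F = "\<lambda>i b. \<Sum>c<L i. \<Sum>e<L i. F i (R i x) b c e"])
  moreover have "(\<Sum>x<2 ^ n. \<Prod>i<r. \<Sum>b<L i. \<Sum>c<L i. \<Sum>e<L i. F i (R i x) b c e) =
      (\<Prod>i<r. \<Sum>a<L i. \<Sum>b<L i. \<Sum>c<L i. \<Sum>e<L i. F i a b c e)"
    by (rule *[where F = "\<lambda>i a. \<Sum>b<L i. \<Sum>c<L i. \<Sum>e<L i. F i a b c e"])
  ultimately show ?thesis by (simp only:)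
qed

lemma sum_swap4:
  "(\<Sum>x\<in>A. \<Sum>y\<in>A. \<Sum>z\<in>A. \<Sum>w\<in>A. \<Sum>s\<in>S. F x y z w s) =
   (\<Sum>s\<in>S. \<Sum>x\<in>A. \<Sum>y\<in>A. \<Sum>z\<in>A. \<Sum>w\<in>A. F x y z w s)"
  by (simp only: sum.swap[of _ A S])

text \<open>On a ring of Suc k patches superblock p spans the patches p and p + 1, so patch p is
  shared by the superblocks \<open>cyclic_pred k p\<close> and p.\<close>

definition cyclic_pred :: "nat \<Rightarrow> nat \<Rightarrow> nat" where
  "cyclic_pred k p = (if p = 0 then k else p - 1)"

lemma prod_cyclic_pred:
  "(\<Prod>p<Suc k. h (cyclic_pred k p) p) = (\<Prod>p<k. h p (Suc p)) * (h k 0 :: 'a :: comm_monoid_mult)"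
  unfolding prod.lessThan_Suc_shift by (simp add: cyclic_pred_def mult.commute)

text \<open>Reindexes the ring so that factors listed by superblock become factors listed by the
  patch that they concern.\<close>

lemma prod_cyclic_shift:
  "(\<Prod>p<Suc k. h p ((p + 1) mod Suc k)) = (\<Prod>p<Suc k. h (cyclic_pred k p) p :: 'a :: comm_monoid_mult)"
  unfolding prod_cyclic_pred by simp

lemma two_layer_fourth_moment:
  fixes d D :: real
  assumes H: "haar_orthogonal (2 ^ (2 * \<xi>)) H" and "0 < \<xi>" "even m" "0 < m"
  defines "d \<equiv> 2 ^ \<xi>" and "D \<equiv> 2 ^ (2 * \<xi>)"
  shows "(\<integral>A. \<bar>A $$ (0, 0)\<bar> ^ 4 \<partial>two_layer_ensemble m \<xi> H) =
    ((d ^ 2 + 2 * d) ^ m + 2 * (d ^ 2 - d) ^ m) / (D * (D + 2)) ^ m"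
proof -
  obtain k where m: "m = Suc k" using \<open>0 < m\<close> by (cases m) auto
  let ?N = "2 ^ (m * \<xi>) :: nat"
  let ?S = "PiE {..<m} (\<lambda>_. {..<3::nat})"
  let ?r = "\<lambda>p. restrict_qubits (patch \<xi> p)"
  define g where "g p s x y z w = replica_pairing s (patch \<xi> p) x y z w" for p s x y z w
  define T :: "nat \<Rightarrow> nat \<Rightarrow> real" where "T s t = (d ^ 2 - d) * of_bool (s = t) + d" for s t
  have "(\<Prod>p<m. \<Sum>s<3. replica_pairing s (patch \<xi> p @ patch \<xi> ((p + 1) mod m)) x y z w) =
      (\<Sum>s\<in>?S. \<Prod>p<m. g p (s p) x y z w * g p (s (cyclic_pred k p)) x y z w)" for x y z w
  proof -
    have "(\<Prod>p<m. \<Sum>s<3. replica_pairing s (patch \<xi> p @ patch \<xi> ((p + 1) mod m)) x y z w) =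
        (\<Sum>s\<in>?S. \<Prod>p<m. g p (s p) x y z w * g ((p + 1) mod m) (s p) x y z w)"
      unfolding replica_pairing_append g_def by (rule prod_sum_PiE) auto
    also have "\<dots> = (\<Sum>s\<in>?S. \<Prod>p<m. g p (s p) x y z w * g p (s (cyclic_pred k p)) x y z w)"
      using prod_cyclic_shift[where k = k and h = "\<lambda>p q. g q (s p) x y z w" for s]
      unfolding prod.distrib m by simp
    finally show ?thesis .
  qed
  then have "(\<integral>A. \<bar>A $$ (0, 0)\<bar> ^ 4 \<partial>two_layer_ensemble m \<xi> H) =
    (\<Sum>s\<in>?S. \<Sum>x<?N. \<Sum>y<?N. \<Sum>z<?N. \<Sum>w<?N.
      \<Prod>p<m. g p (s p) x y z w * g p (s (cyclic_pred k p)) x y z w) / (D * (D + 2)) ^ m"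
    unfolding two_layer_fourth_moment_expand[OF H \<open>0 < \<xi>\<close> \<open>even m\<close>] D_def
    by (simp only: prod_dividef prod_constant card_lessThan sum_divide_distrib[symmetric] sum_swap4)
  \<comment> \<open>For fixed pairings the sum over the replicas factors over the patches, and each
    patch contributes the overlap \<open>T\<close> of the pairings of its two superblocks.\<close>
  also have "(\<Sum>s\<in>?S. \<Sum>x<?N. \<Sum>y<?N. \<Sum>z<?N. \<Sum>w<?N.
      \<Prod>p<m. g p (s p) x y z w * g p (s (cyclic_pred k p)) x y z w) =
      (\<Sum>s\<in>?S. \<Prod>p<m. T (s (cyclic_pred k p)) (s p))"
  proof (intro sum.cong refl)
    fix s assume s: "s \<in> ?S"
    have "(\<Sum>x<?N. \<Sum>y<?N. \<Sum>z<?N. \<Sum>w<?N.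
        \<Prod>p<m. g p (s p) x y z w * g p (s (cyclic_pred k p)) x y z w) =
        (\<Prod>p<m. \<Sum>a<2 ^ \<xi>. \<Sum>b<2 ^ \<xi>. \<Sum>c<2 ^ \<xi>. \<Sum>e<2 ^ \<xi>.
          pairing (s p) a b c e * pairing (s (cyclic_pred k p)) a b c e)"
      unfolding g_def
      using sum_prod_restrict_qubits4[OF partitions_qubits_patch[OF \<open>0 < \<xi>\<close>, of m], where
          F = "\<lambda>p a b c e. pairing (s p) a b c e * pairing (s (cyclic_pred k p)) a b c e"]
      by (simp only: patch_simps)
    also have "\<dots> = (\<Prod>p<m. T (s (cyclic_pred k p)) (s p))"
    proof (intro prod.cong refl)
      fix p assume "p \<in> {..<m}"
      then have "s p < 3" "s (cyclic_pred k p) < 3"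
        using s m by (auto simp: cyclic_pred_def PiE_iff)
      then show "(\<Sum>a<2 ^ \<xi>. \<Sum>b<2 ^ \<xi>. \<Sum>c<2 ^ \<xi>. \<Sum>e<2 ^ \<xi>.
          pairing (s p) a b c e * pairing (s (cyclic_pred k p)) a b c e) = T (s (cyclic_pred k p)) (s p)"
        by (simp add: sum_pairing_mult_pairing T_def d_def eq_commute)
    qed
    finally show "(\<Sum>x<?N. \<Sum>y<?N. \<Sum>z<?N. \<Sum>w<?N.
        \<Prod>p<m. g p (s p) x y z w * g p (s (cyclic_pred k p)) x y z w) =
      (\<Prod>p<m. T (s (cyclic_pred k p)) (s p))" .
  qed
  \<comment> \<open>Cutting the ring at patch 0 leaves an open chain of k bonds and one closing
    bond.\<close>
  also have "\<dots> = (\<Sum>s\<in>?S. (\<Prod>p<k. T (s (Suc p)) (s p)) * T (s 0) (s k))"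
    using prod_cyclic_pred[where k = k and h = "\<lambda>p q. T (s p) (s q)" for s]
    unfolding m by (simp add: T_def eq_commute)
  \<comment> \<open>The eigenvalues are (d ^ 2 - d) + 3 d = d ^ 2 + 2 d and, twice, d ^ 2 -
    d.\<close>
  also have "\<dots> = (d ^ 2 + 2 * d) ^ m + 2 * (d ^ 2 - d) ^ m"
    using sum_closed_chain[where q = 3 and k = k and a = "d ^ 2 - d" and b = d] unfolding T_def m
    by (simp add: add.commute)
  finally show ?thesis .
qed

section \<open>Comparison with the Haar value\<close>

lemma anti_concentration_bound:
  fixes d :: nat and m :: nat and \<epsilon> :: real
  assumes d: "0 < d" and m: "2 \<le> m" and \<epsilon>: "0 < \<epsilon>" "\<epsilon> < 1" and small: "real m / real d \<le> \<epsilon> / 2"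
  defines "D \<equiv> real d ^ 2" and "N \<equiv> real d ^ m"
  shows "((real d ^ 2 + 2 * real d) ^ m + 2 * (real d ^ 2 - real d) ^ m) / (D * (D + 2)) ^ m
    \<le> (1 + \<epsilon>) * (3 / (N * (N + 2)))"
proof -
  define x where "x = real m / real d"
  have x: "0 \<le> x" "x \<le> \<epsilon> / 2" "x \<le> 1 / 2" using small \<epsilon> by (auto simp: x_def)
  have d1: "1 \<le> real d" using d by simp
  have pos: "0 < D" "0 < N" using d by (auto simp: D_def N_def)
  have "1 + 2 / real d \<le> exp (2 / real d)" by (rule exp_ge_add_one_self)
  then have "(1 + 2 / real d) ^ m \<le> exp (2 / real d) ^ m" by (intro power_mono) auto
  also have "\<dots> = exp (2 * x)" by (simp add: x_def flip: exp_of_nat_mult)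
  also have "\<dots> \<le> 1 + 2 * x + (2 * x)\<^sup>2" using x by (intro exp_bound) auto
  \<comment> \<open>Since x is at most 1/2, the quadratic term 4 x^2 is at most 2 x, and 1 + 4 x is
    at most 1 + 2 epsilon. The looser 3 epsilon is what \<open>num\<close> can afford: the other two
    summands are at most 1 each, and 3 (1 + epsilon) is the target.\<close>
  also have "\<dots> \<le> 1 + 3 * \<epsilon>"
  proof -
    have "x\<^sup>2 \<le> x * (1 / 2)" using x unfolding power2_eq_square by (intro mult_left_mono) auto
    then show ?thesis using x by (simp add: power_mult_distrib)
  qed
  finally have 1: "(1 + 2 / real d) ^ m \<le> 1 + 3 * \<epsilon>" .
  have "(1 - 1 / real d) ^ m \<le> 1" using d1 by (intro power_le_one) (auto simp: field_simps)
  with 1 have num: "(1 + 2 / real d) ^ m + 2 * (1 - 1 / real d) ^ m \<le> 3 * (1 + \<epsilon>)" by simp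
  \<comment> \<open>At least two patches give d ^ 2 <= d ^ m, so a single one of the m factors 1 + 2
    / D already dominates the Haar correction 1 + 2 / N.\<close>
  have "D \<le> N" unfolding D_def N_def using d1 m by (intro power_increasing) auto
  then have "1 + 2 / N \<le> (1 + 2 / D) ^ 1" using pos by (simp add: field_simps)
  also have "\<dots> \<le> (1 + 2 / D) ^ m" using pos m by (intro power_increasing) auto
  finally have den: "1 + 2 / N \<le> (1 + 2 / D) ^ m" .
  define A B E where "A = (1 + 2 / real d) ^ m" "B = (1 - 1 / real d) ^ m" "E = (1 + 2 / D) ^ m"
  \<comment> \<open>Pulling out D lets D ^ m cancel; the D ^ m remaining in the denominator is N ^
    2, and with the factor 1 + 2 / N it becomes N (N + 2).\<close>
  have factor: "real d ^ 2 + 2 * real d = D * (1 + 2 / real d)"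
    "real d ^ 2 - real d = D * (1 - 1 / real d)" "D * (D + 2) = D * D * (1 + 2 / D)"
    using d by (simp_all add: D_def field_simps power2_eq_square)
  have "((real d ^ 2 + 2 * real d) ^ m + 2 * (real d ^ 2 - real d) ^ m) / (D * (D + 2)) ^ m
      = (D ^ m * A + 2 * (D ^ m * B)) / (D ^ m * D ^ m * E)"
    by (simp only: factor power_mult_distrib A_B_E_def)
  also have "\<dots> = (D ^ m * (A + 2 * B)) / (D ^ m * (D ^ m * E))"
    by (simp add: algebra_simps)
  also have "\<dots> = (A + 2 * B) / (D ^ m * E)"
    using pos by simp
  also have "\<dots> \<le> (3 * (1 + \<epsilon>)) / (D ^ m * (1 + 2 / N))"
    using num den pos \<epsilon> unfolding A_B_E_def by (intro frac_le mult_left_mono mult_pos_pos) (auto intro: add_pos_pos)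
  also have "D ^ m = N * N" by (simp add: D_def N_def power_mult_distrib power2_eq_square)
  also have "N * N * (1 + 2 / N) = N * (N + 2)" using pos by (simp add: field_simps)
  finally show ?thesis by (simp add: mult.commute)
qed

text \<open>The factor 2 before the logarithm makes 2 ^ xi at least (n / epsilon) ^ 2. Then 2 m <= n
  ^ 2 <= epsilon (n / epsilon) ^ 2, using m <= n, 2 <= n and epsilon < 1.\<close>

lemma patch_dimension_large:
  fixes \<epsilon> :: real and n m \<xi> :: nat
  assumes "n = m * \<xi>" "0 < \<xi>" "2 \<le> m" "0 < \<epsilon>" "\<epsilon> < 1" and \<xi>: "2 * log 2 (real n / \<epsilon>) \<le> real \<xi>"
  shows "real m / 2 ^ \<xi> \<le> \<epsilon> / 2"
proof -
  have n: "m \<le> n" "2 \<le> n" using assms by (auto simp: intro: order_trans)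
  have n\<epsilon>: "0 < real n / \<epsilon>" using n assms by simp
  have "(real n / \<epsilon>)\<^sup>2 = 2 powr (2 * log 2 (real n / \<epsilon>))"
    unfolding mult_2 powr_add using n\<epsilon> by (simp add: power2_eq_square)
  also have "\<dots> \<le> 2 powr real \<xi>" using \<xi> by (intro powr_mono) auto
  finally have d: "(real n / \<epsilon>)\<^sup>2 \<le> 2 ^ \<xi>" by (simp add: powr_realpow)
  have "real m * 2 \<le> real n * real n" using n by (intro mult_mono) auto
  also have "\<dots> \<le> \<epsilon> * (real n / \<epsilon>)\<^sup>2"
  proof -
    have "real n * real n * 1 \<le> real n * real n * (1 / \<epsilon>)" using assms by (intro mult_left_mono) auto
    also have "\<dots> = \<epsilon> * (real n / \<epsilon>)\<^sup>2" using assms by (simp add: power2_eq_square)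
    finally show ?thesis by simp
  qed
  also have "\<dots> \<le> \<epsilon> * 2 ^ \<xi>" using d assms by (intro mult_left_mono) auto
  finally show ?thesis by (simp add: field_simps)
qed

theorem theoremS22:
  shows "\<exists>C>0::real. \<forall>\<epsilon>::real. 0 < \<epsilon> \<and> \<epsilon> < 1 \<longrightarrow>
    (\<forall>(n::nat) (m::nat) (\<xi>::nat) (H::real mat measure) (G::real mat measure).
       n = m * \<xi> \<and> 0 < m \<and> even m \<and> 0 < \<xi> \<and>
       real \<xi> \<ge> C * log 2 (real n / \<epsilon>) \<and>
       haar_orthogonal (2 ^ (2 * \<xi>)) H \<and>
       haar_orthogonal (2 ^ n) G \<longrightarrow>
       (\<integral>A. \<bar>A $$ (0, 0)\<bar> ^ 4 \<partial>two_layer_ensemble m \<xi> H)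
         \<le> (1 + \<epsilon>) * (\<integral>A. \<bar>A $$ (0, 0)\<bar> ^ 4 \<partial>G))"
proof (intro exI[of _ 2] conjI allI impI; (elim conjE)?)
  fix \<epsilon> :: real and n m \<xi> :: nat and H G :: "real mat measure"
  assume \<epsilon>: "0 < \<epsilon>" "\<epsilon> < 1" and n: "n = m * \<xi>" and m: "0 < m" "even m" and \<xi>: "0 < \<xi>"
    and large: "real \<xi> \<ge> 2 * log 2 (real n / \<epsilon>)"
    and H: "haar_orthogonal (2 ^ (2 * \<xi>)) H" and G: "haar_orthogonal (2 ^ n) G"
  have m2: "2 \<le> m" using m by (auto elim: evenE)
  \<comment> \<open>The witness C = 2 is the constant for which \<open>patch_dimension_large\<close>
    applies.\<close>
  have small: "real m / real (2 ^ \<xi>) \<le> \<epsilon> / 2"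
    using patch_dimension_large[OF n \<xi> m2 \<epsilon>] large by simp
  have pos: "0 < (2::nat) ^ \<xi>" by simp
  have "0 < n" using n m \<xi> by simp
  then have "2 \<le> (2::nat) ^ n" using power_increasing[of 1 n "2::nat"] by simp
  then interpret G: invariant_unit_vector G "2 ^ n" "\<lambda>A i. A $$ (i, 0)"
    by (rule invariant_unit_vector_column[OF G]) simp
  have abs4: "\<bar>a\<bar> ^ 4 = a * a * a * a" for a :: real
    by (simp only: power_even_abs_numeral even_numeral) (simp add: power4_eq_xxxx)
  \<comment> \<open>The Haar side is a pure fourth moment of column 0, in dimension 2 ^ n.\<close>
  have "(\<integral>A. \<bar>A $$ (0, 0)\<bar> ^ 4 \<partial>G) = 3 / (2 ^ n * (2 ^ n + 2))"
    using G.moment_fourth[of 0] unfolding abs4 by (simp add: G.moment_def)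
  moreover have "(2::real) ^ n = (2 ^ \<xi>) ^ m" "(2::real) ^ (2 * \<xi>) = (2 ^ \<xi>)\<^sup>2"
    by (simp_all add: n mult.commute flip: power_mult)
  ultimately show "(\<integral>A. \<bar>A $$ (0, 0)\<bar> ^ 4 \<partial>two_layer_ensemble m \<xi> H)
      \<le> (1 + \<epsilon>) * (\<integral>A. \<bar>A $$ (0, 0)\<bar> ^ 4 \<partial>G)"
    unfolding two_layer_fourth_moment[OF H \<xi> m(2,1)]
    using anti_concentration_bound[OF pos m2 \<epsilon> small]
    by (simp only: of_nat_power of_nat_numeral)
qed simp

end
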